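(* For $n\ge3$, $\max_{\pi\in S_n}\operatorname{sd}_{132}(\pi)=n-1$.
   Context: $S_n$ is the set of permutations of $[n]$ in one-line notation. Two sequences of distinct integers have the same relative order if replacing the $i$th smallest entry of each by $i$ yields the same word; a sequence contains $\sigma$ classically if some (not necessarily consecutive) subsequence has the same relative order as $\sigma$, and avoids it otherwise. $s_{132}:S_n\to S_n$ sends a permutation through a stack: at each step, if there is a next input entry and placing it on top of the stack would make the stack contents, read top to bottom, avoid $132$ classically, push it; otherwise pop the top entry of the stack to the end of the output; stop when the output has length $n$. For $\pi\in S_n$, $\operatorname{sd}_{132}(\pi)$ is the smallest nonnegative integer $t$ such that $s_{132}^t(\pi)$ avoids both $132$ and $231$ classically ($s_{132}^0$ is the identity map). *)

theory Defs
  imports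
    "HOL-Combinatorics.Multiset_Permutations"
    "HOL-Library.Sublist"
    "HOL-Library.Extended_Nat"
begin

text \<open>Permutations of \<open>[n]\<close> in one-line notation are the lists in
  \<^term>\<open>permutations_of_set {1..n}\<close>.\<close>

definition standardize :: "nat list \<Rightarrow> nat list" where
  "standardize xs = map (\<lambda>x. card {y \<in> set xs. y \<le> x}) xs"

definition same_relative_order :: "nat list \<Rightarrow> nat list \<Rightarrow> bool" where
  "same_relative_order xs ys \<longleftrightarrow> standardize xs = standardize ys"

definition contains_pattern :: "nat list \<Rightarrow> nat list \<Rightarrow> bool" where
  "contains_pattern xs \<sigma> \<longleftrightarrow> (\<exists>ys. subseq ys xs \<and> same_relative_order ys \<sigma>)"

abbreviation avoids_pattern :: "nat list \<Rightarrow> nat list \<Rightarrow> bool" where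
  "avoids_pattern xs \<sigma> \<equiv> \<not> contains_pattern xs \<sigma>"

text \<open>The arguments are the remaining input, the stack (head = top) and the output so far.
  An entry can always be pushed onto an empty stack, so the run ends exactly when input and
  stack are both exhausted, i.e. when the output has the length of the original input
  (lemma \<open>mset_stack_run\<close> below).\<close>

function stack_run :: "nat list \<Rightarrow> nat list \<Rightarrow> nat list \<Rightarrow> nat list" where
  "stack_run inp st out =
     (if inp \<noteq> [] \<and> avoids_pattern (hd inp # st) [1, 3, 2]
      then stack_run (tl inp) (hd inp # st) out
      else if st \<noteq> [] then stack_run inp (tl st) (out @ [hd st])
      else out)"
  by auto
termination
  by (relation "measure (\<lambda>(inp, st, out). 2 * length inp + length st)")
     (auto simp: neq_Nil_conv)

declare stack_run.simps [simp del]

definition s132 :: "nat list \<Rightarrow> nat list" where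
  "s132 \<pi> = stack_run \<pi> [] []"

text \<open>The value is \<open>\<infinity>\<close> if no iterate of \<open>\<pi>\<close> avoids both patterns.\<close>

definition sd132 :: "nat list \<Rightarrow> enat" where
  "sd132 \<pi> = (INF t \<in> {t. avoids_pattern ((s132 ^^ t) \<pi>) [1, 3, 2] \<and>
                          avoids_pattern ((s132 ^^ t) \<pi>) [2, 3, 1]}. enat t)"

lemma avoids_132_singleton: "avoids_pattern [x] [1, 3, 2]"
proof
  assume "contains_pattern [x] [1, 3, 2]"
  then obtain ys where ys: "subseq ys [x]" "standardize ys = standardize [1, 3, 2]"
    by (auto simp: contains_pattern_def same_relative_order_def)
  from ys(2) have "length ys = 3"
    by (auto simp: standardize_def dest: arg_cong[where f = length])
  with list_emb_length[OF ys(1)] show False by simp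
qed

lemma mset_stack_run: "mset (stack_run inp st out) = mset inp + mset st + mset out"
proof (induction inp st out rule: stack_run.induct)
  case (1 inp st out)
  show ?case
  proof (cases "inp \<noteq> [] \<and> avoids_pattern (hd inp # st) [1, 3, 2]")
    case True
    with 1(1)[OF True] show ?thesis
      by (subst stack_run.simps) (cases inp; simp)
  next
    case push: False
    show ?thesis
    proof (cases "st = []")
      case False
      with 1(2)[OF push False] push show ?thesis
        by (subst stack_run.simps) (cases st; auto)
    next
      case True
      with push have "inp = []" using avoids_132_singleton by auto
      with True show ?thesis by (subst stack_run.simps) simp
    qed
  qed
qed

lemma s132_permutation:
  assumes "\<pi> \<in> permutations_of_set A"
  shows "s132 \<pi> \<in> permutations_of_set A"
proof -
  have "mset (s132 \<pi>) = mset \<pi>"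
    by (simp add: s132_def mset_stack_run)
  with assms show ?thesis
    by (metis mset_eq_setD mset_eq_imp_distinct_iff permutations_of_setD
        permutations_of_setI)
qed

end

theory Submission
  imports Defs
begin

text \<open>Avoiding 132 and 231 means decreasing first and increasing afterwards.

  A left-to-right minimum finds the stack increasing from top to bottom once it has been pushed, and
  an increasing bottom part of the stack is never popped early. Hence \<open>s132\<close> maps \<open>A 1 B\<close> to
  \<open>A' B' 1 C\<close> with \<open>C\<close> the left-to-right minima of \<open>A\<close> in increasing order, and \<open>B'\<close> is the reversal of
  \<open>B\<close> if \<open>B\<close> is increasing. After \<open>t\<close> steps the entries up to \<open>t\<close> therefore form a valley around \<open>1\<close>,
  because \<open>t + 1\<close> either already follows that valley in the increasing part or is a left-to-right
  minimum. So \<open>n - 1\<close> steps suffice.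

  The bound is attained by the entries congruent to 1 modulo 3 in decreasing order followed by all
  other entries in decreasing order: after \<open>t \<ge> 2\<close> steps the residue classes of \<open>t + 1\<close>, \<open>t + 2\<close> and
  \<open>t + 3\<close> are still in separate monotone runs, and \<open>t + 1, t + 2, 1\<close> is an occurrence of 231.\<close>

section \<open>Occurrences of 132 and 231\<close>

text \<open>\<open>standardize\<close> replaces each entry by its rank, and rank is strictly
  monotone on the set of entries. Equal standardizations can therefore be turned back into
  inequalities between entries.\<close>

lemma card_le_less_iff:
  fixes x y :: nat
  assumes "finite A" "x \<in> A" "y \<in> A"
  shows "card {z \<in> A. z \<le> x} < card {z \<in> A. z \<le> y} \<longleftrightarrow> x < y"
proof -
  have less: "card {z \<in> A. z \<le> a} < card {z \<in> A. z \<le> b}"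
    if "a < b" "b \<in> A" for a b :: nat
  proof (rule psubset_card_mono)
    have "b \<in> {z \<in> A. z \<le> b}" "b \<notin> {z \<in> A. z \<le> a}" using that by auto
    moreover have "{z \<in> A. z \<le> a} \<subseteq> {z \<in> A. z \<le> b}" using that by auto
    ultimately show "{z \<in> A. z \<le> a} \<subset> {z \<in> A. z \<le> b}" by blast
  qed (use assms in simp)
  show ?thesis
    using less[of x y] less[of y x] assms by (metis less_asym linorder_neqE_nat less_irrefl)
qed

lemma standardize_132:
  "standardize ys = standardize [1, 3, 2] \<longleftrightarrow> (\<exists>a c b. ys = [a, c, b] \<and> a < b \<and> b < c)"
proof
  have std: "standardize [1, 3, 2] = [1, 3, 2]"
  proof -
    have "{y::nat. (y = 1 \<or> y = 3 \<or> y = 2) \<and> y \<le> 1} = {1}"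
      "{y::nat. (y = 1 \<or> y = 3 \<or> y = 2) \<and> y \<le> 3} = {1, 3, 2}"
      "{y::nat. (y = 1 \<or> y = 3 \<or> y = 2) \<and> y \<le> 2} = {1, 2}"
      by auto
    then show ?thesis by (simp add: standardize_def)
  qed
  {
    assume eq: "standardize ys = standardize [1, 3, 2]"
    then have "length ys = 3" by (auto simp: standardize_def dest: arg_cong[where f = length])
    then obtain a c b where ys: "ys = [a, c, b]"
      by (auto simp: length_Suc_conv numeral_3_eq_3)
    have "a < b \<and> b < c"
      using eq card_le_less_iff[of "set ys" a b] card_le_less_iff[of "set ys" b c]
      unfolding std by (simp add: standardize_def ys)
    with ys show "\<exists>a c b. ys = [a, c, b] \<and> a < b \<and> b < c" by blast
  next
    assume "\<exists>a c b. ys = [a, c, b] \<and> a < b \<and> b < c"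
    then obtain a c b where ys: "ys = [a, c, b]" "a < b" "b < c" by blast
    then have "{y. (y = a \<or> y = c \<or> y = b) \<and> y \<le> a} = {a}"
      "{y. (y = a \<or> y = c \<or> y = b) \<and> y \<le> c} = {a, c, b}"
      "{y. (y = a \<or> y = c \<or> y = b) \<and> y \<le> b} = {a, b}"
      by auto
    then show "standardize ys = standardize [1, 3, 2]"
      unfolding std using ys by (simp add: standardize_def)
  }
qed

lemma standardize_231:
  "standardize ys = standardize [2, 3, 1] \<longleftrightarrow> (\<exists>b c a. ys = [b, c, a] \<and> a < b \<and> b < c)"
proof
  have std: "standardize [2, 3, 1] = [2, 3, 1]"
  proof -
    have "{y::nat. (y = 2 \<or> y = 3 \<or> y = 1) \<and> y \<le> 1} = {1}"
      "{y::nat. (y = 2 \<or> y = 3 \<or> y = 1) \<and> y \<le> 3} = {1, 3, 2}"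
      "{y::nat. (y = 2 \<or> y = 3 \<or> y = 1) \<and> y \<le> 2} = {1, 2}"
      by auto
    then show ?thesis by (simp add: standardize_def)
  qed
  {
    assume eq: "standardize ys = standardize [2, 3, 1]"
    then have "length ys = 3" by (auto simp: standardize_def dest: arg_cong[where f = length])
    then obtain b c a where ys: "ys = [b, c, a]"
      by (auto simp: length_Suc_conv numeral_3_eq_3)
    have "a < b \<and> b < c"
      using eq card_le_less_iff[of "set ys" a b] card_le_less_iff[of "set ys" b c]
      unfolding std by (simp add: standardize_def ys)
    with ys show "\<exists>b c a. ys = [b, c, a] \<and> a < b \<and> b < c" by blast
  next
    assume "\<exists>b c a. ys = [b, c, a] \<and> a < b \<and> b < c"
    then obtain b c a where ys: "ys = [b, c, a]" "a < b" "b < c" by blast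
    then have "{y. (y = b \<or> y = c \<or> y = a) \<and> y \<le> a} = {a}"
      "{y. (y = b \<or> y = c \<or> y = a) \<and> y \<le> c} = {a, c, b}"
      "{y. (y = b \<or> y = c \<or> y = a) \<and> y \<le> b} = {a, b}"
      by auto
    then show "standardize ys = standardize [2, 3, 1]"
      unfolding std using ys by (simp add: standardize_def)
  }
qed

lemma contains_132_iff:
  "contains_pattern xs [1, 3, 2] \<longleftrightarrow> (\<exists>a c b. subseq [a, c, b] xs \<and> a < b \<and> b < c)"
  unfolding contains_pattern_def same_relative_order_def standardize_132 by blast

lemma contains_231_iff:
  "contains_pattern xs [2, 3, 1] \<longleftrightarrow> (\<exists>b c a. subseq [b, c, a] xs \<and> a < b \<and> b < c)"
  unfolding contains_pattern_def same_relative_order_def standardize_231 by blast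

lemma sorted_wrt_subseq_pair:
  assumes "sorted_wrt R xs" "subseq [x, y] xs"
  shows "R x y"
proof -
  from assms(2) obtain us vs where "xs = us @ x # vs" "subseq [y] vs"
    by (auto dest: list_emb_ConsD)
  with assms(1) show ?thesis
    by (auto simp: sorted_wrt_append subseq_singleton_left)
qed

lemma not_sorted_imp_descent:
  fixes xs :: "'a :: linorder list"
  assumes "\<not> sorted xs"
  shows "\<exists>c b. subseq [c, b] xs \<and> b < c"
  using assms
proof (induction xs)
  case (Cons x xs)
  show ?case
  proof (cases "sorted xs")
    case True
    with Cons.prems obtain b where "b \<in> set xs" "b < x" by auto
    then show ?thesis by (intro exI[of _ x] exI[of _ b]) (simp add: subseq_singleton_left)
  next
    case False
    with Cons.IH show ?thesis by (meson list_emb_Cons)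
  qed
qed simp

text \<open>The first entry can only play the smallest letter of 132, so a push onto an avoiding
  stack is blocked exactly by a descent whose two entries both exceed the new one.\<close>

lemma contains_132_Cons_iff:
  "contains_pattern (x # xs) [1, 3, 2] \<longleftrightarrow>
     contains_pattern xs [1, 3, 2] \<or> (\<exists>c b. subseq [c, b] xs \<and> x < b \<and> b < c)"
proof -
  have "subseq [a, c, b] (x # xs) \<longleftrightarrow> subseq [a, c, b] xs \<or> a = x \<and> subseq [c, b] xs" for a c b
    by (auto dest: subseq_Cons')
  then show ?thesis unfolding contains_132_iff by blast
qed

lemma sorted_avoids_132: "sorted xs \<Longrightarrow> avoids_pattern (x # xs) [1, 3, 2]"
proof
  assume s: "sorted xs" and "contains_pattern (x # xs) [1, 3, 2]"
  then obtain a c b where "subseq [a, c, b] (x # xs)" "b < c"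
    unfolding contains_132_iff by blast
  then have "subseq [c, b] xs" by (metis subseq_Cons2_iff subseq_Cons')
  with sorted_wrt_subseq_pair[OF s this] \<open>b < c\<close> show False by simp
qed

text \<open>No value lies strictly between \<open>x\<close> and \<open>y\<close>, so
  \<open>y\<close> cannot start a descent whose entries both exceed \<open>x\<close>.\<close>

lemma sorted_avoids_132_Suc:
  assumes "sorted xs" "y = Suc x"
  shows "avoids_pattern (x # y # xs) [1, 3, 2]"
proof
  assume "contains_pattern (x # y # xs) [1, 3, 2]"
  then obtain c b where cb: "subseq [c, b] (y # xs)" "x < b" "b < c"
    using sorted_avoids_132[OF assms(1)] unfolding contains_132_Cons_iff[of x] by blast
  then have "subseq [c, b] xs" using assms(2) by (auto split: if_splits)
  with sorted_wrt_subseq_pair[OF assms(1)] cb(3) show False by fastforce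
qed

text \<open>132 and 231 are the patterns of length three with the largest letter in the middle. Here
  the middle letter either follows \<open>x\<close> within \<open>p\<close> or precedes
  \<open>z\<close> within \<open>r\<close>.\<close>

lemma valley_no_peak:
  fixes p r :: "'a :: linorder list"
  assumes "sorted_wrt (\<ge>) p" "sorted r" "subseq [x, y, z] (p @ r)"
  shows "y \<le> x \<or> y \<le> z"
proof -
  from assms(3) obtain us vs where uv: "[x, y, z] = us @ vs" "subseq us p" "subseq vs r"
    by (auto simp: subseq_append_iff)
  show ?thesis
  proof (cases us)
    case Nil
    with uv have "subseq [x, y, z] r" by simp
    then have "subseq [y, z] r" by (meson subseq_Cons')
    then show ?thesis using sorted_wrt_subseq_pair[OF assms(2)] by simp
  next
    case (Cons u us')
    show ?thesis
    proof (cases us')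
      case Nil
      with Cons uv have "subseq [y, z] r" by simp
      then show ?thesis using sorted_wrt_subseq_pair[OF assms(2)] by simp
    next
      case (Cons v us'')
      with uv(1) \<open>us = u # us'\<close> have "subseq [x, y] us" by simp
      then have "subseq [x, y] p" using uv(2) by (rule subseq_order.trans)
      then show ?thesis using sorted_wrt_subseq_pair[OF assms(1)] by simp
    qed
  qed
qed

lemma valley_avoids_132:
  "sorted_wrt (\<ge>) p \<Longrightarrow> sorted r \<Longrightarrow> avoids_pattern (p @ r) [1, 3, 2]"
  unfolding contains_132_iff by (metis leD less_trans valley_no_peak)

lemma valley_avoids_231:
  "sorted_wrt (\<ge>) p \<Longrightarrow> sorted r \<Longrightarrow> avoids_pattern (p @ r) [2, 3, 1]"
  unfolding contains_231_iff by (metis leD less_trans valley_no_peak)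

section \<open>Runs of the stack\<close>

lemma stack_run_Nil: "stack_run [] st out = out @ st"
proof (induction st arbitrary: out)
  case Nil
  show ?case by (subst stack_run.simps) simp
next
  case (Cons x st)
  then show ?case by (subst stack_run.simps) simp
qed

lemma stack_run_push:
  "avoids_pattern (x # st) [1, 3, 2] \<Longrightarrow> stack_run (x # inp) st out = stack_run inp (x # st) out"
  by (subst stack_run.simps) simp

lemma stack_run_pop:
  "contains_pattern (x # y # st) [1, 3, 2] \<Longrightarrow>
    stack_run (x # inp) (y # st) out = stack_run (x # inp) st (out @ [y])"
  by (subst stack_run.simps) simp

text \<open>Read from the top, \<open>x\<close>, \<open>y\<close>, \<open>z\<close> would be an
  occurrence of 132.\<close>

lemma stack_run_pop_above:
  assumes "x < z" "z < y" "z \<in> set st"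
  shows "stack_run (x # inp) (y # st) out = stack_run (x # inp) st (out @ [y])"
proof (rule stack_run_pop)
  have "subseq [y, z] (y # st)" using assms by (simp add: subseq_singleton_left)
  then show "contains_pattern (x # y # st) [1, 3, 2]"
    using assms unfolding contains_132_Cons_iff[of x] by blast
qed

lemma stack_run_step:
  "\<exists>st' out'. avoids_pattern (x # st') [1, 3, 2] \<and> suffix st' st \<and>
     stack_run (x # inp) st out = stack_run inp (x # st') out'"
proof (induction st arbitrary: out)
  case Nil
  show ?case
    using avoids_132_singleton stack_run_push[of x "[]"] by blast
next
  case (Cons y st)
  show ?case
  proof (cases "contains_pattern (x # y # st) [1, 3, 2]")
    case True
    from Cons.IH[of "out @ [y]"] show ?thesis
      unfolding stack_run_pop[OF True] by (meson suffix_ConsI)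
  next
    case False
    then show ?thesis using stack_run_push by blast
  qed
qed

text \<open>Recording only the set of stack entries suffices: when a left-to-right minimum arrives,
  the whole stack is known to exceed it.\<close>

lemma stack_run_append:
  "\<exists>st' out'. set st' \<subseteq> set inp \<union> set st \<and> stack_run (inp @ rest) st out = stack_run rest st' out'"
proof (induction inp arbitrary: st out)
  case Nil
  show ?case by auto
next
  case (Cons x inp)
  obtain st1 out1 where 1: "suffix st1 st"
    "stack_run (x # inp @ rest) st out = stack_run (inp @ rest) (x # st1) out1"
    using stack_run_step by blast
  obtain st2 out2 where 2: "set st2 \<subseteq> set inp \<union> set (x # st1)"
    "stack_run (inp @ rest) (x # st1) out1 = stack_run rest st2 out2"
    using Cons.IH by blast
  have "set st2 \<subseteq> set (x # inp) \<union> set st"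
    using 2(1) set_mono_suffix[OF 1(1)] by auto
  with 1(2) 2(2) show ?case by (metis append_Cons)
qed

text \<open>Only descents of the stack (read from the top) can trigger a pop, so an increasing bottom
  part is never touched before the input is exhausted.\<close>

lemma stack_run_retains_sorted:
  assumes "sorted d"
  shows "\<exists>w. stack_run inp (u @ d) out = out @ w @ d"
proof (induction inp "u @ d" out arbitrary: u rule: stack_run.induct)
  case (1 inp out)
  show ?case
  proof (cases "inp \<noteq> [] \<and> avoids_pattern (hd inp # u @ d) [1, 3, 2]")
    case True
    from 1(1)[OF True, of "hd inp # u"] obtain w where
      "stack_run (tl inp) (hd inp # u @ d) out = out @ w @ d" by auto
    then show ?thesis using True stack_run_push[of "hd inp" "u @ d" "tl inp" out] by auto
  next
    case False
    show ?thesis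
    proof (cases u)
      case Nil
      with False sorted_avoids_132[OF assms] have "inp = []" by auto
      with Nil show ?thesis by (auto simp: stack_run_Nil)
    next
      case (Cons y u')
      from 1(2)[OF False, of u'] Cons obtain w where
        w: "stack_run inp (u' @ d) (out @ [y]) = (out @ [y]) @ w @ d" by auto
      have "stack_run inp (u @ d) out = stack_run inp (u' @ d) (out @ [y])"
        by (subst stack_run.simps) (use False Cons in auto)
      with w show ?thesis by auto
    qed
  qed
qed

lemma stack_run_push_decreasing:
  assumes "sorted (rev d @ st)"
  shows "stack_run (d @ inp) st out = stack_run inp (rev d @ st) out"
  using assms
proof (induction d arbitrary: st)
  case (Cons x d)
  have "sorted st" using Cons.prems by (simp add: sorted_append)
  then show ?case
    using Cons by (simp add: stack_run_push[OF sorted_avoids_132])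
qed simp

text \<open>Each pushed entry is at least all of \<open>u\<close>, so the stack read from the top
  stays a valley, and valleys avoid 132. Nothing is popped before the input ends.\<close>

lemma stack_run_increasing:
  assumes "sorted_wrt (\<ge>) u" "sorted d" "sorted inp" "\<forall>x\<in>set u. \<forall>y\<in>set inp. x \<le> y"
  shows "stack_run inp (u @ d) out = out @ rev inp @ u @ d"
  using assms
proof (induction inp arbitrary: u)
  case Nil
  show ?case by (simp add: stack_run_Nil)
next
  case (Cons x inp)
  have "sorted_wrt (\<ge>) (x # u)" using Cons.prems by auto
  then have "avoids_pattern (x # u @ d) [1, 3, 2]"
    using valley_avoids_132[of "x # u" d] Cons.prems by simp
  then have "stack_run (x # inp) (u @ d) out = stack_run inp ((x # u) @ d) out"
    by (simp add: stack_run_push)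
  also have "\<dots> = out @ rev inp @ (x # u) @ d"
    by (rule Cons.IH) (use Cons.prems in auto)
  finally show ?case by simp
qed

section \<open>Left-to-right minima in a pass\<close>

text \<open>Everything below \<open>m\<close> in the stack exceeds it, so a descent there would form
  a 132 with \<open>m\<close>; the push happens only once the stack is increasing.\<close>

lemma s132_left_to_right_min:
  assumes "\<forall>a\<in>set xs. m < a"
  shows "\<exists>st out. sorted (m # st) \<and> s132 (xs @ m # ys) = stack_run ys (m # st) out"
proof -
  obtain st out where st: "set st \<subseteq> set xs"
    "s132 (xs @ m # ys) = stack_run (m # ys) st out"
    using stack_run_append[of xs "[]" "m # ys" "[]"] unfolding s132_def by auto
  obtain st' out' where st': "avoids_pattern (m # st') [1, 3, 2]" "suffix st' st"
    "stack_run (m # ys) st out = stack_run ys (m # st') out'"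
    using stack_run_step by blast
  have less: "\<forall>a\<in>set st'. m < a"
    using assms st(1) set_mono_suffix[OF st'(2)] by blast
  have "sorted st'"
  proof (rule ccontr)
    assume "\<not> sorted st'"
    then obtain c b where cb: "subseq [c, b] st'" "b < c"
      using not_sorted_imp_descent by blast
    then have "b \<in> set st'" using subseq_singleton_left subseq_Cons' by metis
    with less cb st'(1) show False unfolding contains_132_Cons_iff[of m] by blast
  qed
  with less have "sorted (m # st')" by auto
  with st(2) st'(3) show ?thesis by auto
qed

lemma s132_left_to_right_min_tail:
  assumes "\<forall>a\<in>set xs. m < a"
  shows "\<exists>ws st. sorted (m # st) \<and> s132 (xs @ m # ys) = ws @ m # st"
proof -
  obtain st out where st: "sorted (m # st)" "s132 (xs @ m # ys) = stack_run ys (m # st) out"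
    using s132_left_to_right_min[OF assms] by blast
  moreover obtain w where "stack_run ys ([] @ m # st) out = out @ w @ m # st"
    using stack_run_retains_sorted[OF st(1)] by blast
  ultimately have "s132 (xs @ m # ys) = (out @ w) @ m # st" by simp
  with st(1) show ?thesis by blast
qed

lemma s132_min_increasing:
  assumes "\<forall>a\<in>set xs. m < a" "sorted (m # ys)"
  shows "\<exists>ws st. sorted (m # st) \<and> s132 (xs @ m # ys) = ws @ rev ys @ m # st"
proof -
  obtain st out where "sorted (m # st)" "s132 (xs @ m # ys) = stack_run ys (m # st) out"
    using s132_left_to_right_min[OF assms(1)] by blast
  moreover have "stack_run ys ([] @ m # st) out = out @ rev ys @ [] @ m # st"
    by (rule stack_run_increasing) (use calculation assms in auto)
  ultimately show ?thesis by auto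
qed

section \<open>The upper bound\<close>

text \<open>The invariant of the upper bound: only the prefix \<open>p\<close> may spoil the valley
  around 1. The valley itself may also contain entries above \<open>t\<close>.\<close>

definition sorted_up_to :: "nat \<Rightarrow> nat list \<Rightarrow> bool" where
  "sorted_up_to t \<pi> \<longleftrightarrow> (\<exists>p q r. \<pi> = p @ q @ 1 # r \<and> (\<forall>x\<in>set p. t < x) \<and>
     sorted_wrt (\<ge>) q \<and> sorted r)"

lemma permutation_split_1:
  fixes n :: nat
  assumes "\<pi> \<in> permutations_of_set {1..n}" "\<pi> = xs @ 1 # ys"
  shows "\<forall>a\<in>set xs. 1 < a" "\<forall>a\<in>set ys. 1 < a"
proof -
  have "1 < a" if "a \<in> set xs \<union> set ys" for a
  proof -
    have "a \<noteq> 1" "1 \<le> a"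
      using permutations_of_setD[OF assms(1)] assms(2) that by auto
    then show ?thesis by simp
  qed
  then show "\<forall>a\<in>set xs. 1 < a" "\<forall>a\<in>set ys. 1 < a" by auto
qed

text \<open>One pass makes the part after 1 increasing; everything before 1 exceeds 1 and is taken
  as the prefix \<open>p\<close>.\<close>

lemma sorted_up_to_1_s132:
  assumes "\<pi> \<in> permutations_of_set {1..n}" "n \<ge> 1"
  shows "sorted_up_to 1 (s132 \<pi>)"
proof -
  have "1 \<in> set \<pi>" using permutations_of_setD(1)[OF assms(1)] assms(2) by simp
  then obtain xs ys where \<pi>: "\<pi> = xs @ 1 # ys" by (meson split_list)
  obtain ws st where ws: "sorted (1 # st)" "s132 \<pi> = ws @ 1 # st"
    using s132_left_to_right_min_tail permutation_split_1(1)[OF assms(1) \<pi>] unfolding \<pi> by blast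
  have "\<forall>x\<in>set ws. 1 < x"
    using permutation_split_1(1)[OF s132_permutation[OF assms(1)] ws(2)] .
  then show ?thesis unfolding sorted_up_to_def using ws
    by (intro exI[of _ ws] exI[of _ "[]"] exI[of _ st]) auto
qed

text \<open>An entry \<open>x \<le> t + 1\<close> left of \<open>1\<close> is a left-to-right minimum, so it stays in the stack until
  the end and leaves it after \<open>1\<close>. The new decreasing part is the old increasing part, reversed.\<close>

lemma sorted_up_to_Suc_s132:
  assumes perm: "\<pi> \<in> permutations_of_set {1..n}" and srt: "sorted_up_to t \<pi>"
  shows "sorted_up_to (Suc t) (s132 \<pi>)"
proof -
  obtain p q r where \<pi>: "\<pi> = p @ q @ 1 # r" and p: "\<forall>x\<in>set p. t < x"
    and q: "sorted_wrt (\<ge>) q" and r: "sorted r"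
    using srt unfolding sorted_up_to_def by blast
  have \<pi>': "\<pi> = (p @ q) @ 1 # r" using \<pi> by simp
  note gt1 = permutation_split_1[OF perm \<pi>']
  have "sorted (1 # r)" using r gt1(2) by (auto intro: less_imp_le)
  then obtain ws st where st: "sorted (1 # st)" and out: "s132 \<pi> = ws @ rev r @ 1 # st"
    using s132_min_increasing[OF gt1(1)] unfolding \<pi>' by blast
  have perm': "s132 \<pi> \<in> permutations_of_set {1..n}" using s132_permutation[OF perm] .
  have dist: "distinct \<pi>" "distinct (s132 \<pi>)" "set (s132 \<pi>) = set \<pi>"
    using permutations_of_setD[OF perm] permutations_of_setD[OF perm'] by auto
  have "Suc t < x" if x: "x \<in> set ws" for x
  proof (rule ccontr)
    assume "\<not> Suc t < x"
    then have xt: "x \<le> Suc t" by simp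
    have "x \<in> set \<pi>" using dist(3) out x by auto
    moreover have "x \<notin> set (1 # r)" using dist(2) out x by auto
    ultimately have "x \<in> set p \<or> x \<in> set q" using \<pi> by auto
    \<comment> \<open>In either case \<open>x\<close> is a left-to-right minimum: entries of
      \<open>p\<close> exceed \<open>t\<close>, hence are at least \<open>x\<close>, and
      \<open>q\<close> is decreasing.\<close>
    then obtain us vs where uv: "\<pi> = us @ x # vs" "\<forall>u\<in>set us. x < u"
    proof
      assume "x \<in> set p"
      then obtain p1 p2 where p12: "p = p1 @ x # p2" by (meson split_list)
      have "x < u" if "u \<in> set p1" for u
      proof -
        have "x \<le> u" using p p12 that xt by (metis Suc_leI le_trans in_set_conv_decomp append_assoc append_Cons)
        moreover have "x \<noteq> u" using dist(1) that unfolding \<pi> p12 by auto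
        ultimately show ?thesis by simp
      qed
      then show thesis using that[of p1 "p2 @ q @ 1 # r"] unfolding \<pi> p12 by simp
    next
      assume "x \<in> set q"
      then obtain q1 q2 where q12: "q = q1 @ x # q2" by (meson split_list)
      have "x < u" if "u \<in> set (p @ q1)" for u
      proof -
        have "x \<le> u"
        proof (cases "u \<in> set p")
          case True
          with p xt show ?thesis by (meson Suc_leI le_trans)
        next
          case False
          with q q12 that show ?thesis by (auto simp: sorted_wrt_append)
        qed
        moreover have "x \<noteq> u" using dist(1) that unfolding \<pi> q12 by auto
        ultimately show ?thesis by simp
      qed
      then show thesis using that[of "p @ q1" "q2 @ 1 # r"] unfolding \<pi> q12 by simp
    qed
    obtain ws' st' where st': "sorted (x # st')" "s132 \<pi> = ws' @ x # st'"
      using s132_left_to_right_min_tail[OF uv(2)] unfolding uv(1) by blast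
    obtain w1 w2 where w12: "ws = w1 @ x # w2" using x by (meson split_list)
    \<comment> \<open>Entries are distinct, so both decompositions of the output are cut at the same
      \<open>x\<close>, and the increasing tail starting at \<open>x\<close> contains 1.\<close>
    have "w1 @ x # (w2 @ rev r @ 1 # st) = ws' @ x # st'"
      using out st'(2) w12 by simp
    moreover have "x \<notin> set w1" "x \<notin> set (w2 @ rev r @ 1 # st)"
      using dist(2) unfolding out w12 by auto
    ultimately have "st' = w2 @ rev r @ 1 # st"
      by (simp add: append_Cons_eq_iff)
    then have "x \<le> 1" using st'(1) by simp
    moreover have "1 < x" using permutation_split_1(1)[OF perm', of "ws @ rev r" st] out x by simp
    ultimately show False by simp
  qed
  then show ?thesis unfolding sorted_up_to_def using out r st
    by (intro exI[of _ ws] exI[of _ "rev r"] exI[of _ st]) (auto simp: sorted_wrt_rev)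
qed

lemma iterate_s132_permutation:
  "\<pi> \<in> permutations_of_set A \<Longrightarrow> (s132 ^^ t) \<pi> \<in> permutations_of_set A"
  by (induction t) (auto intro: s132_permutation)

lemma iterate_sorted_up_to:
  assumes "\<pi> \<in> permutations_of_set {1..n}" "n \<ge> 1"
  shows "sorted_up_to (Suc t) ((s132 ^^ Suc t) \<pi>)"
proof (induction t)
  case 0
  show ?case using sorted_up_to_1_s132[OF assms] by simp
next
  case (Suc t)
  then show ?case
    using sorted_up_to_Suc_s132[OF iterate_s132_permutation[OF assms(1), of "Suc t"]] by simp
qed

text \<open>For \<open>t = n - 1\<close> the prefix can contain nothing but \<open>n\<close>, which
  only extends the decreasing part \<open>q\<close>.\<close>

lemma sorted_up_to_avoids:
  assumes "\<pi> \<in> permutations_of_set {1..n}" "sorted_up_to (n - 1) \<pi>"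
  shows "avoids_pattern \<pi> [1, 3, 2]" "avoids_pattern \<pi> [2, 3, 1]"
proof -
  obtain p q r where \<pi>: "\<pi> = p @ q @ 1 # r" and p: "\<forall>x\<in>set p. n - 1 < x"
    and q: "sorted_wrt (\<ge>) q" and r: "sorted r"
    using assms(2) unfolding sorted_up_to_def by blast
  have \<pi>': "\<pi> = (p @ q) @ 1 # r" using \<pi> by simp
  have le: "set p \<subseteq> {1..n}" "set q \<subseteq> {1..n}"
    using permutations_of_setD[OF assms(1)] unfolding \<pi> by auto
  have n: "x = n" if "x \<in> set p" for x using p le that by fastforce
  have "sorted_wrt (\<ge>) p"
    using n by (induction p) auto
  moreover have "\<forall>x\<in>set p. \<forall>y\<in>set q. y \<le> x" using n le(2) by fastforce
  ultimately have 1: "sorted_wrt (\<ge>) (p @ q)" using q by (simp add: sorted_wrt_append)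
  have 2: "sorted (1 # r)"
    using r permutation_split_1(2)[OF assms(1) \<pi>'] by (auto intro: less_imp_le)
  show "avoids_pattern \<pi> [1, 3, 2]" "avoids_pattern \<pi> [2, 3, 1]"
    unfolding \<pi>' using valley_avoids_132[OF 1 2] valley_avoids_231[OF 1 2] by auto
qed

lemma sd132_le:
  assumes "\<pi> \<in> permutations_of_set {1..n}" "n \<ge> 2"
  shows "sd132 \<pi> \<le> enat (n - 1)"
  unfolding sd132_def
proof (rule INF_lower)
  obtain t where t: "n - 1 = Suc t" using assms(2) by (cases "n - 1") auto
  have "sorted_up_to (n - 1) ((s132 ^^ (n - 1)) \<pi>)"
    unfolding t using iterate_sorted_up_to assms by simp
  from sorted_up_to_avoids[OF iterate_s132_permutation[OF assms(1)] this]
  show "n - 1 \<in> {t. avoids_pattern ((s132 ^^ t) \<pi>) [1, 3, 2] \<and>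
      avoids_pattern ((s132 ^^ t) \<pi>) [2, 3, 1]}"
    by simp
qed

section \<open>A slowest permutation\<close>

function class3 :: "nat \<Rightarrow> nat \<Rightarrow> nat list" where
  "class3 n k = (if k \<le> n then k # class3 n (k + 3) else [])"
  by auto
termination by (relation "measure (\<lambda>(n, k). n + 1 - k)") auto

text \<open>Built from blocks \<open>k + 1, k\<close> because a pass treats each block as a unit;
  the block of largest values comes first and may be cut to a single entry.\<close>

function pairs_down :: "nat \<Rightarrow> nat \<Rightarrow> nat list" where
  "pairs_down n k =
     (if k \<le> n then pairs_down n (k + 3) @ (if k + 1 \<le> n then [k + 1, k] else [k]) else [])"
  by auto
termination by (relation "measure (\<lambda>(n, k). n + 1 - k)") auto

text \<open>The blocks of \<open>pairs_down\<close> in the same order, each reversed.\<close>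

function pairs_up :: "nat \<Rightarrow> nat \<Rightarrow> nat list" where
  "pairs_up n k =
     (if k \<le> n then pairs_up n (k + 3) @ (if k + 1 \<le> n then [k, k + 1] else [k]) else [])"
  by auto
termination by (relation "measure (\<lambda>(n, k). n + 1 - k)") auto

declare class3.simps [simp del] pairs_down.simps [simp del] pairs_up.simps [simp del]

lemma set_class3: "set (class3 n k) = {x \<in> {k..n}. x mod 3 = k mod 3}"
proof (induction n k rule: class3.induct)
  case (1 n k)
  show ?case
  proof (cases "k \<le> n")
    case True
    have "x = k \<or> k + 3 \<le> x" if "x mod 3 = k mod 3" "k \<le> x" for x
    proof -
      have "3 dvd x - k" using that by (simp add: mod_eq_dvd_iff_nat)
      then have "x - k = 0 \<or> 3 \<le> x - k" using dvd_imp_le by auto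
      with that(2) show ?thesis by auto
    qed
    then show ?thesis
      using True 1 by (subst class3.simps) fastforce
  next
    case False
    then show ?thesis by (subst class3.simps) auto
  qed
qed

lemma sorted_class3: "sorted (class3 n k) \<and> distinct (class3 n k)"
proof (induction n k rule: class3.induct)
  case (1 n k)
  then show ?case
    by (subst (1 2) class3.simps) (auto simp: set_class3)
qed

lemma set_pairs_down: "k mod 3 = 2 \<Longrightarrow> set (pairs_down n k) = {x \<in> {k..n}. x mod 3 \<noteq> 1}"
proof (induction n k rule: pairs_down.induct)
  case (1 n k)
  show ?case
  proof (cases "k \<le> n")
    case True
    have "x mod 3 \<noteq> 1 \<and> k \<le> x \<longleftrightarrow> x = k \<or> x = k + 1 \<or> x mod 3 \<noteq> 1 \<and> k + 3 \<le> x" for x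
      using 1(2) by presburger
    then show ?thesis
      using True 1 by (subst pairs_down.simps) auto
  next
    case False
    then show ?thesis by (subst pairs_down.simps) auto
  qed
qed

lemma distinct_pairs_down: "k mod 3 = 2 \<Longrightarrow> distinct (pairs_down n k)"
proof (induction n k rule: pairs_down.induct)
  case (1 n k)
  then show ?case
    by (subst pairs_down.simps) (auto simp: set_pairs_down)
qed

section \<open>Passes over residue-class words\<close>

text \<open>The entry \<open>k + 1\<close> is pushed and then popped by its successor in the input,
  which is below the \<open>k\<close> waiting in the stack. The last pop happens only when
  \<open>x\<close> arrives, hence \<open>x\<close> in the statement.\<close>

lemma stack_run_class3:
  assumes "sorted st" "set (class3 n k) \<subseteq> set st" "x < k"
  shows "stack_run (rev (class3 n (k + 1)) @ x # rest) st out =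
    stack_run (x # rest) st (out @ rev (class3 n (k + 1)))"
  using assms
proof (induction n k arbitrary: x rest rule: class3.induct)
  case (1 n k)
  show ?case
  proof (cases "k + 1 \<le> n")
    case True
    have c: "class3 n (k + 1) = (k + 1) # class3 n (k + 3 + 1)"
      using True by (subst class3.simps) (simp add: ac_simps)
    have k: "class3 n k = k # class3 n (k + 3)"
      using True by (subst class3.simps) simp
    have "stack_run (rev (class3 n (k + 1)) @ x # rest) st out =
        stack_run (rev (class3 n (k + 3 + 1)) @ (k + 1) # x # rest) st out"
      unfolding c by simp
    also have "\<dots> = stack_run ((k + 1) # x # rest) st (out @ rev (class3 n (k + 3 + 1)))"
      by (rule 1(1)) (use True 1(2-) k in auto)
    also have "\<dots> = stack_run (x # rest) ((k + 1) # st) (out @ rev (class3 n (k + 3 + 1)))"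
      by (rule stack_run_push) (rule sorted_avoids_132[OF 1(2)])
    also have "\<dots> = stack_run (x # rest) st ((out @ rev (class3 n (k + 3 + 1))) @ [k + 1])"
      by (rule stack_run_pop_above[of x k]) (use 1(3,4) k in auto)
    finally show ?thesis unfolding c by simp
  next
    case False
    then have "class3 n (k + 1) = []" by (subst class3.simps) simp
    then show ?thesis by simp
  qed
qed

text \<open>Being consecutive values, \<open>k + 2\<close> and \<open>k + 1\<close> can share the
  stack; the next entry, below the stacked \<open>k\<close>, pops both, so the block comes out
  reversed.\<close>

lemma stack_run_pairs_down:
  assumes "sorted st" "set (class3 n k) \<subseteq> set st" "x < k"
  shows "stack_run (pairs_down n (k + 1) @ x # rest) st out =
    stack_run (x # rest) st (out @ pairs_up n (k + 1))"
  using assms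
proof (induction n k arbitrary: x rest rule: class3.induct)
  case (1 n k)
  show ?case
  proof (cases "k + 1 \<le> n")
    case True
    have k: "class3 n k = k # class3 n (k + 3)"
      using True by (subst class3.simps) simp
    have IH: "stack_run (pairs_down n (k + 3 + 1) @ y # rest') st out =
      stack_run (y # rest') st (out @ pairs_up n (k + 3 + 1))" if "y < k + 3" for y rest'
      by (rule 1(1)) (use True 1(2-) k that in auto)
    show ?thesis
    proof (cases "k + 2 \<le> n")
      case two: True
      have d: "pairs_down n (k + 1) = pairs_down n (k + 3 + 1) @ [k + 2, k + 1]"
        using True two by (subst pairs_down.simps) (simp add: ac_simps)
      have u: "pairs_up n (k + 1) = pairs_up n (k + 3 + 1) @ [k + 1, k + 2]"
        using True two by (subst pairs_up.simps) (simp add: ac_simps)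
      let ?out = "out @ pairs_up n (k + 3 + 1)"
      have av: "avoids_pattern ((k + 1) # (k + 2) # st) [1, 3, 2]"
        by (rule sorted_avoids_132_Suc[OF 1(2)]) simp
      have "stack_run (pairs_down n (k + 1) @ x # rest) st out =
          stack_run (pairs_down n (k + 3 + 1) @ (k + 2) # (k + 1) # x # rest) st out"
        unfolding d by simp
      also have "\<dots> = stack_run ((k + 2) # (k + 1) # x # rest) st ?out"
        by (rule IH) simp
      also have "\<dots> = stack_run ((k + 1) # x # rest) ((k + 2) # st) ?out"
        by (rule stack_run_push) (rule sorted_avoids_132[OF 1(2)])
      also have "\<dots> = stack_run (x # rest) ((k + 1) # (k + 2) # st) ?out"
        by (rule stack_run_push) (rule av)
      also have "\<dots> = stack_run (x # rest) ((k + 2) # st) (?out @ [k + 1])"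
        by (rule stack_run_pop_above[of x k]) (use 1(3,4) k in auto)
      also have "\<dots> = stack_run (x # rest) st ((?out @ [k + 1]) @ [k + 2])"
        by (rule stack_run_pop_above[of x k]) (use 1(3,4) k in auto)
      finally show ?thesis unfolding u by simp
    next
      case one: False
      have d: "pairs_down n (k + 1) = pairs_down n (k + 3 + 1) @ [k + 1]"
        using True one by (subst pairs_down.simps) (simp add: ac_simps)
      have u: "pairs_up n (k + 1) = pairs_up n (k + 3 + 1) @ [k + 1]"
        using True one by (subst pairs_up.simps) (simp add: ac_simps)
      let ?out = "out @ pairs_up n (k + 3 + 1)"
      have "stack_run (pairs_down n (k + 1) @ x # rest) st out =
          stack_run (pairs_down n (k + 3 + 1) @ (k + 1) # x # rest) st out"
        unfolding d by simp
      also have "\<dots> = stack_run ((k + 1) # x # rest) st ?out"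
        by (rule IH) simp
      also have "\<dots> = stack_run (x # rest) ((k + 1) # st) ?out"
        by (rule stack_run_push) (rule sorted_avoids_132[OF 1(2)])
      also have "\<dots> = stack_run (x # rest) st (?out @ [k + 1])"
        by (rule stack_run_pop_above[of x k]) (use 1(3,4) k in auto)
      finally show ?thesis unfolding u by simp
    qed
  next
    case False
    then have "pairs_down n (k + 1) = []" "pairs_up n (k + 1) = []"
      by (subst pairs_down.simps pairs_up.simps, simp)+
    then show ?thesis by simp
  qed
qed

text \<open>Each \<open>k\<close> stays and later serves as the deeper entry that makes the next
  input pop \<open>k + 1\<close>. One class collects in the stack, the other goes to the output in
  decreasing order.\<close>

lemma stack_run_pairs_up:
  assumes "x < k"
  shows "stack_run (pairs_up n k @ x # rest) [] [] =
    stack_run (x # rest) (class3 n k) (rev (class3 n (k + 1)))"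
  using assms
proof (induction n k arbitrary: x rest rule: class3.induct)
  case (1 n k)
  show ?case
  proof (cases "k \<le> n")
    case True
    have k: "class3 n k = k # class3 n (k + 3)"
      using True by (subst class3.simps) simp
    \<comment> \<open>The induction hypothesis with \<open>k\<close> as next input entry, followed
      by the push of \<open>k\<close>.\<close>
    have IH: "stack_run (pairs_up n (k + 3) @ k # rest') [] [] =
      stack_run rest' (class3 n k) (rev (class3 n (k + 3 + 1)))" for rest'
      using 1(1)[OF True, of k rest'] sorted_avoids_132[of "class3 n (k + 3)" k]
        sorted_class3[of n "k + 3"] stack_run_push[of k "class3 n (k + 3)" rest']
      unfolding k by simp
    show ?thesis
    proof (cases "k + 1 \<le> n")
      case two: True
      have u: "pairs_up n k = pairs_up n (k + 3) @ [k, k + 1]"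
        using True two by (subst pairs_up.simps) simp
      have c: "class3 n (k + 1) = (k + 1) # class3 n (k + 3 + 1)"
        using two by (subst class3.simps) (simp add: ac_simps)
      have "stack_run (pairs_up n k @ x # rest) [] [] =
          stack_run ((k + 1) # x # rest) (class3 n k) (rev (class3 n (k + 3 + 1)))"
        using IH unfolding u by simp
      also have "\<dots> = stack_run (x # rest) ((k + 1) # class3 n k) (rev (class3 n (k + 3 + 1)))"
        by (rule stack_run_push[OF sorted_avoids_132]) (simp add: sorted_class3)
      also have "\<dots> = stack_run (x # rest) (class3 n k) (rev (class3 n (k + 3 + 1)) @ [k + 1])"
        by (rule stack_run_pop_above[of x k]) (use 1(2) k in auto)
      finally show ?thesis unfolding c by simp
    next
      case False
      have "pairs_up n k = pairs_up n (k + 3) @ [k]"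
        using True False by (subst pairs_up.simps) simp
      moreover have "class3 n (k + 1) = []" "class3 n (k + 3 + 1) = []"
        using False by (subst class3.simps, simp)+
      ultimately show ?thesis using IH by simp
    qed
  next
    case False
    then have "pairs_up n k = []" "class3 n k = []" "class3 n (k + 1) = []"
      by (subst pairs_up.simps class3.simps, simp)+
    then show ?thesis by simp
  qed
qed

text \<open>For \<open>n = 9\<close> the orbit is \<open>741986532\<close>, \<open>895623147\<close>, \<open>963741258\<close>, \<open>748521369\<close>, \<open>859631247\<close>, ...;
  from the third term on it has the regular shape \<open>slow_state\<close>.\<close>

definition slow_perm :: "nat \<Rightarrow> nat list" where
  "slow_perm n = rev (class3 n 1) @ pairs_down n 2"

lemma slow_perm_permutation: "slow_perm n \<in> permutations_of_set {1..n}"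
proof (rule permutations_of_setI)
  have "x mod 3 = 0 \<or> x mod 3 = 1 \<or> x mod 3 = 2" for x :: nat by presburger
  moreover have "x \<ge> 2" if "x \<ge> 1" "x mod 3 \<noteq> 1" for x :: nat
    using that by (cases "x = 1") auto
  ultimately show "set (slow_perm n) = {1..n}"
    by (auto simp: slow_perm_def set_class3 set_pairs_down)
  show "distinct (slow_perm n)"
    by (auto simp: slow_perm_def sorted_class3 distinct_pairs_down set_class3 set_pairs_down)
qed

lemma pairs_down_2: "n \<ge> 3 \<Longrightarrow> pairs_down n 2 = pairs_down n 5 @ [3, 2]"
  by (subst pairs_down.simps) simp

lemma pairs_up_2: "n \<ge> 3 \<Longrightarrow> pairs_up n 2 = pairs_up n 5 @ [2, 3]"
  by (subst pairs_up.simps) simp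

lemma class3_Cons: "k \<le> n \<Longrightarrow> class3 n k = k # class3 n (k + 3)"
  by (subst class3.simps) simp

text \<open>The last block \<open>3, 2\<close> is handled apart: no later entry pops it, so it
  leaves only after the input is exhausted.\<close>

lemma s132_slow_perm:
  assumes "n \<ge> 3"
  shows "s132 (slow_perm n) = pairs_up n 2 @ class3 n 1"
proof -
  have srt: "sorted (class3 n 1)" by (simp add: sorted_class3)
  have sub: "set (class3 n 4) \<subseteq> set (class3 n 1)" by (auto simp: set_class3)
  have av: "avoids_pattern (2 # 3 # class3 n 1) [1, 3, 2]"
    by (rule sorted_avoids_132_Suc[OF srt]) simp
  have "s132 (slow_perm n) = stack_run (rev (class3 n 1) @ pairs_down n 2) [] []"
    by (simp add: s132_def slow_perm_def)
  also have "\<dots> = stack_run (pairs_down n 2) (class3 n 1) []"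
    using stack_run_push_decreasing[of "rev (class3 n 1)" "[]"] srt by simp
  also have "\<dots> = stack_run [3, 2] (class3 n 1) (pairs_up n 5)"
    using stack_run_pairs_down[OF srt sub, of 3 "[2]" "[]"] assms by (simp add: pairs_down_2)
  also have "\<dots> = stack_run [2] (3 # class3 n 1) (pairs_up n 5)"
    by (rule stack_run_push) (rule sorted_avoids_132[OF srt])
  also have "\<dots> = stack_run [] (2 # 3 # class3 n 1) (pairs_up n 5)"
    by (rule stack_run_push) (rule av)
  finally show ?thesis using assms by (simp add: stack_run_Nil pairs_up_2)
qed

text \<open>The exact contents of \<open>q\<close> and \<open>r\<close> are left open: being at most
  \<open>t\<close>, their entries lie below all three classes, and the runs need no more.\<close>

definition slow_state :: "nat \<Rightarrow> nat \<Rightarrow> nat list \<Rightarrow> bool" where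
  "slow_state n t \<pi> \<longleftrightarrow> (\<exists>q r.
     \<pi> = rev (class3 n (t + 1)) @ rev (class3 n (t + 2)) @ q @ 1 # r @ class3 n (t + 3) \<and>
     sorted_wrt (\<ge>) q \<and> sorted r \<and> set q \<subseteq> {1..t} \<and> set r \<subseteq> {1..t})"

lemma slow_state_2:
  assumes "n \<ge> 3"
  shows "slow_state n 2 ((s132 ^^ 2) (slow_perm n))"
proof -
  have funpow_2: "(s132 ^^ 2) xs = s132 (s132 xs)" for xs
    by (simp add: numeral_2_eq_2)
  have c1: "class3 n 1 = 1 # class3 n 4" and c2: "class3 n 2 = 2 # class3 n 5"
    using assms class3_Cons[of 1 n] class3_Cons[of 2 n] by simp_all
  have "(s132 ^^ 2) (slow_perm n) = stack_run (pairs_up n 2 @ 1 # class3 n 4) [] []"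
    using s132_slow_perm[OF assms] unfolding c1 funpow_2 by (simp only: s132_def)
  also have "\<dots> = stack_run (1 # class3 n 4) (class3 n 2) (rev (class3 n 3))"
    using stack_run_pairs_up[of 1 2 n "class3 n 4"] by simp
  also have "\<dots> = stack_run (class3 n 4) ([] @ 1 # class3 n 2) (rev (class3 n 3))"
    unfolding append_Nil
    by (rule stack_run_push[OF sorted_avoids_132]) (simp add: sorted_class3)
  also have "\<dots> = rev (class3 n 3) @ rev (class3 n 4) @ [] @ 1 # class3 n 2"
    by (rule stack_run_increasing) (auto simp: sorted_class3 set_class3)
  \<comment> \<open>The tail \<open>class3 n 2\<close> is split as \<open>[2]\<close> followed by
    \<open>class3 n 5\<close>, the class of \<open>t + 3\<close> for \<open>t = 2\<close>.\<close>
  finally show ?thesis unfolding slow_state_def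
    by (intro exI[of _ "[]"] exI[of _ "[2]"]) (simp add: c2)
qed

text \<open>The class of \<open>t + 1\<close> separates consecutive entries of the class of \<open>t + 2\<close>, so each of the latter is
  popped as soon as the next one arrives: this class keeps its order, while the class of \<open>t + 1\<close> moves
  to the end.\<close>

lemma slow_state_Suc:
  assumes "slow_state n t \<pi>" "1 \<le> t" "t < n"
  shows "slow_state n (Suc t) (s132 \<pi>)"
proof -
  let ?st = "class3 n (t + 1)" and ?e = "rev (class3 n (t + 2))"
  obtain q r where \<pi>: "\<pi> = rev ?st @ ?e @ q @ 1 # r @ class3 n (t + 3)"
    and q: "sorted_wrt (\<ge>) q" "set q \<subseteq> {1..t}" and r: "sorted r" "set r \<subseteq> {1..t}"
    using assms(1) unfolding slow_state_def by blast
  let ?rest = "r @ class3 n (t + 3)"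
  have srt: "sorted ?st" by (simp add: sorted_class3)
  \<comment> \<open>\<open>stack_run_class3\<close> needs the next input entry explicitly; it is 1
    if \<open>q\<close> is empty.\<close>
  obtain x xs where x: "q @ [1] = x # xs" by (cases "q @ [1]") auto
  have "x < t + 1" using x q(2) assms(2) by (cases q) auto
  have dec: "sorted (rev (q @ [1]) @ ?st)"
    using q assms(2) by (fastforce simp: sorted_append sorted_wrt_rev set_class3 sorted_class3)
  have rest: "sorted ?rest"
    using r by (fastforce simp: sorted_append set_class3 sorted_class3)
  have "s132 \<pi> = stack_run (rev ?st @ ?e @ q @ 1 # ?rest) [] []"
    by (simp add: s132_def \<pi>)
  also have "\<dots> = stack_run (?e @ q @ 1 # ?rest) ?st []"
    using stack_run_push_decreasing[of "rev ?st" "[]"] srt by simp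
  also have "q @ 1 # ?rest = x # xs @ ?rest" using x by (metis append_Cons append_Nil append_assoc)
  also have "stack_run (?e @ x # xs @ ?rest) ?st [] = stack_run (x # xs @ ?rest) ?st ?e"
    using stack_run_class3[OF srt _ \<open>x < t + 1\<close>, of n "xs @ ?rest" "[]"] by simp
  also have "x # xs @ ?rest = (q @ [1]) @ ?rest" using x by simp
  also have "stack_run ((q @ [1]) @ ?rest) ?st ?e = stack_run ?rest ([] @ rev (q @ [1]) @ ?st) ?e"
    using stack_run_push_decreasing[OF dec] by simp
  also have "\<dots> = ?e @ rev ?rest @ [] @ rev (q @ [1]) @ ?st"
    by (rule stack_run_increasing) (use dec rest in auto)
  finally have s: "s132 \<pi> = ?e @ rev ?rest @ rev (q @ [1]) @ ?st" by simp
  \<comment> \<open>The smallest entry of the old first class joins the increasing part of the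
    valley; the remaining class starts at \<open>Suc t + 3\<close>.\<close>
  have c: "?st = (t + 1) # class3 n (Suc t + 3)"
    using class3_Cons[of "t + 1" n] assms(3) by (simp add: ac_simps)
  have "s132 \<pi> = rev (class3 n (Suc t + 1)) @ rev (class3 n (Suc t + 2)) @ rev r @
      1 # (rev q @ [t + 1]) @ class3 n (Suc t + 3)"
    unfolding s c by (simp add: eval_nat_numeral)
  moreover have "sorted_wrt (\<ge>) (rev r)" "sorted (rev q @ [t + 1])"
    using r q by (fastforce simp: sorted_wrt_rev sorted_append)+
  moreover have "set (rev r) \<subseteq> {1..Suc t}" "set (rev q @ [t + 1]) \<subseteq> {1..Suc t}"
    using r(2) q(2) by auto
  ultimately show ?thesis unfolding slow_state_def by blast
qed

lemma iterate_slow_state: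
  assumes "n \<ge> 3" "t + 2 \<le> n"
  shows "slow_state n (t + 2) ((s132 ^^ (t + 2)) (slow_perm n))"
  using assms(2)
proof (induction t)
  case 0
  show ?case using slow_state_2[OF assms(1)] by (simp add: numeral_2_eq_2)
next
  case (Suc t)
  then show ?case using slow_state_Suc[of n "t + 2"] by simp
qed

lemma slow_state_contains_231:
  assumes "slow_state n t \<pi>" "1 \<le> t" "t + 2 \<le> n"
  shows "contains_pattern \<pi> [2, 3, 1]"
proof -
  obtain q r where \<pi>: "\<pi> = rev (class3 n (t + 1)) @ rev (class3 n (t + 2)) @ q @ 1 # r"
    using assms(1) unfolding slow_state_def by auto
  have "subseq [t + 1] (rev (class3 n (t + 1)))" "subseq [t + 2] (rev (class3 n (t + 2)))"
    "subseq [1] (q @ 1 # r)"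
    using assms(3) by (auto simp: subseq_singleton_left set_class3)
  then have "subseq ([t + 1] @ [t + 2] @ [1]) \<pi>"
    unfolding \<pi> by (intro list_emb_append_mono)
  then show ?thesis unfolding contains_231_iff
    using assms(2) by (intro exI[of _ "t + 1"] exI[of _ "t + 2"] exI[of _ 1]) simp
qed

lemma sd132_slow_perm_ge:
  assumes "n \<ge> 3"
  shows "enat (n - 1) \<le> sd132 (slow_perm n)"
  unfolding sd132_def
proof (rule INF_greatest)
  fix t
  assume "t \<in> {t. avoids_pattern ((s132 ^^ t) (slow_perm n)) [1, 3, 2] \<and>
    avoids_pattern ((s132 ^^ t) (slow_perm n)) [2, 3, 1]}"
  then have av: "avoids_pattern ((s132 ^^ t) (slow_perm n)) [1, 3, 2]"
    "avoids_pattern ((s132 ^^ t) (slow_perm n)) [2, 3, 1]"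
    by auto
  have c1: "class3 n 1 = 1 # class3 n 4"
    using assms class3_Cons[of 1 n] by simp
  \<comment> \<open>The regular shape begins after two passes, so the first two terms of the orbit
    get explicit occurrences, of 132 and 231 respectively.\<close>
  consider "t = 0" | "t = 1" | u where "t = u + 2"
    by (metis One_nat_def add_2_eq_Suc' not0_implies_Suc)
  then have "n - 1 \<le> t"
  proof cases
    case 1
    have "subseq [1, 3, 2] (slow_perm n)"
      using subseq_drop_many[of "[1, 3, 2]" "1 # pairs_down n 5 @ [3, 2]" "rev (class3 n 4)"]
        subseq_drop_many[of "[3, 2]" "[3, 2]" "pairs_down n 5"]
      unfolding slow_perm_def c1 pairs_down_2[OF assms] by simp
    then have "contains_pattern (slow_perm n) [1, 3, 2]"
      unfolding contains_132_iff by (intro exI[of _ 1] exI[of _ 3] exI[of _ 2]) simp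
    with av 1 show ?thesis by simp
  next
    case 2
    have "subseq [2, 3, 1] (pairs_up n 2 @ class3 n 1)"
      using subseq_drop_many[of "[2, 3, 1]" "2 # 3 # 1 # class3 n 4" "pairs_up n 5"]
      unfolding c1 pairs_up_2[OF assms] by simp
    then have "contains_pattern (s132 (slow_perm n)) [2, 3, 1]"
      unfolding contains_231_iff s132_slow_perm[OF assms]
      by (intro exI[of _ 2] exI[of _ 3] exI[of _ 1]) simp
    with av 2 show ?thesis by simp
  next
    case (3 u)
    show ?thesis
    proof (rule ccontr)
      assume "\<not> n - 1 \<le> t"
      then have "t + 2 \<le> n" by simp
      moreover from this have "slow_state n t ((s132 ^^ t) (slow_perm n))"
        using iterate_slow_state[of n u] assms 3 by simp
      ultimately show False
        using slow_state_contains_231 av(2) 3 by simp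
    qed
  qed
  then show "enat (n - 1) \<le> enat t" by simp
qed

theorem theorem7p2:
  fixes n :: nat
  assumes "n \<ge> 3"
  shows "Max (sd132 ` permutations_of_set {1..n}) = enat (n - 1)"
proof (rule Max_eqI)
  show "x \<le> enat (n - 1)" if "x \<in> sd132 ` permutations_of_set {1..n}" for x
    using that sd132_le[of _ n] assms by (elim imageE) auto
  have "sd132 (slow_perm n) = enat (n - 1)"
    using sd132_le[OF slow_perm_permutation] sd132_slow_perm_ge[OF assms] assms
    by (intro antisym) auto
  then show "enat (n - 1) \<in> sd132 ` permutations_of_set {1..n}"
    using slow_perm_permutation by (metis imageI)
qed simp

end
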